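(* For each $n$ let $P_n$ be the transition matrix of an irreducible, aperiodic, reversible Markov chain on a finite state space $X_n$ all of whose eigenvalues $1=\beta_1>\beta_2\ge\dots\ge\beta_{|X_n|}\ge 0$ are nonnegative, and let $x=x_n\in X_n$ be a starting state. Let $f_1,\dots,f_{|X_n|}:X_n\to\mathbb{R}$ be a corresponding eigenbasis that is orthonormal in $\ell^2(\pi_n)$, where $\pi_n$ is the stationary measure (the dependence of $\beta_i,f_i$ on $n$ is suppressed). Suppose that, in discrete time and started from $x$, the family exhibits total variation cutoff at $t_n$ with window $w_n$. Assume that there is a function $g:\mathbb{R}\to\mathbb{R}$ that is continuous (or just bounded) such that for every $c\in\mathbb{R}$ $$\limsup_{n\to\infty}\; w_n\Big\{\sum_{i=2}^{|X_n|} f_i(x)^2\,\log^2(\beta_i)\,\beta_i^{2(t_n+cw_n)}\Big\}^{1/2}\le g(c).$$ Assume moreover that the discrete time limit profile $$\Phi_x(c)=\lim_{n\to\infty}\frac12\sum_{y\in X_n}\pi_n(y)\Big|\sum_{i=2}^{|X_n|} f_i(x)f_i(y)\beta_i^{t_n+cw_n}\Big|$$ exists for all $c\in\mathbb{R}$. Then $\Phi_x$ is a continuous function on $\mathbb{R}$.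
   Context: The inner product of $\ell^2(\pi)$ is $\langle f,h\rangle_\pi=\sum_{y}\pi(y)f(y)h(y)$. For real $t>0$ put $$d_x^{(n)}(t)=\frac12\sum_{y\in X_n}\pi_n(y)\Big|\sum_{i=2}^{|X_n|} f_i(x)f_i(y)\beta_i^{t}\Big|;$$ for positive integers $t$ this equals the total variation distance $\|P_n^t(x,\cdot)-\pi_n\|_{\mathrm{T.V.}}=\frac12\sum_{y}|P_n^t(x,y)-\pi_n(y)|$. Cutoff: $t_n>0$ and $w_n>0$ are real sequences with $w_n=o(t_n)$. The family has cutoff at $t_n$ with window $w_n$ (started from $x$) if $$\lim_{c\to\infty}\lim_{n\to\infty} d_x^{(n)}(t_n-cw_n)=1\quad\text{and}\quad \lim_{c\to\infty}\lim_{n\to\infty} d_x^{(n)}(t_n+cw_n)=0.$$ For each fixed $c\in\mathbb{R}$, $t_n+cw_n>0$ for all large $n$, so limits as $n\to\infty$ make sense. Convention: for $s>0$, $0^{s}=0$ and $\log^2(0)\,0^{s}=0$. *)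

theory Defs
  imports "HOL-Analysis.Analysis" "HOL-Library.Landau_Symbols"
begin

text \<open>A chain on a finite state space \<open>X\<close> is given by its transition matrix
  \<open>P :: 'a \<Rightarrow> 'a \<Rightarrow> real\<close>; only the values on \<open>X\<close> matter. Since the type \<open>'a\<close> is arbitrary,
  a sequence of finite state spaces may be taken as a sequence of finite subsets of it.\<close>

definition transition_matrix :: "'a set \<Rightarrow> ('a \<Rightarrow> 'a \<Rightarrow> real) \<Rightarrow> bool" where
  "transition_matrix X P \<longleftrightarrow> finite X \<and> X \<noteq> {} \<and>
     (\<forall>x\<in>X. \<forall>y\<in>X. 0 \<le> P x y) \<and> (\<forall>x\<in>X. (\<Sum>y\<in>X. P x y) = 1)"

primrec matrix_power :: "'a set \<Rightarrow> ('a \<Rightarrow> 'a \<Rightarrow> real) \<Rightarrow> nat \<Rightarrow> 'a \<Rightarrow> 'a \<Rightarrow> real" where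
  "matrix_power X P 0 x y = (if x = y then 1 else 0)"
| "matrix_power X P (Suc k) x y = (\<Sum>z\<in>X. P x z * matrix_power X P k z y)"

definition irreducible_chain :: "'a set \<Rightarrow> ('a \<Rightarrow> 'a \<Rightarrow> real) \<Rightarrow> bool" where
  "irreducible_chain X P \<longleftrightarrow> (\<forall>x\<in>X. \<forall>y\<in>X. \<exists>k. 0 < matrix_power X P k x y)"

definition aperiodic_chain :: "'a set \<Rightarrow> ('a \<Rightarrow> 'a \<Rightarrow> real) \<Rightarrow> bool" where
  "aperiodic_chain X P \<longleftrightarrow> (\<forall>x\<in>X. Gcd {k. 0 < k \<and> 0 < matrix_power X P k x x} = 1)"

definition stationary_measure ::
    "'a set \<Rightarrow> ('a \<Rightarrow> 'a \<Rightarrow> real) \<Rightarrow> ('a \<Rightarrow> real) \<Rightarrow> bool" where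
  "stationary_measure X P \<pi> \<longleftrightarrow> (\<forall>x\<in>X. 0 \<le> \<pi> x) \<and> (\<Sum>x\<in>X. \<pi> x) = 1 \<and>
     (\<forall>y\<in>X. (\<Sum>x\<in>X. \<pi> x * P x y) = \<pi> y)"

definition reversible_chain ::
    "'a set \<Rightarrow> ('a \<Rightarrow> 'a \<Rightarrow> real) \<Rightarrow> ('a \<Rightarrow> real) \<Rightarrow> bool" where
  "reversible_chain X P \<pi> \<longleftrightarrow> (\<forall>x\<in>X. \<forall>y\<in>X. \<pi> x * P x y = \<pi> y * P y x)"

definition l2_inner :: "'a set \<Rightarrow> ('a \<Rightarrow> real) \<Rightarrow> ('a \<Rightarrow> real) \<Rightarrow> ('a \<Rightarrow> real) \<Rightarrow> real" where
  "l2_inner X \<pi> f h = (\<Sum>y\<in>X. \<pi> y * f y * h y)"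

text \<open>A basis of the real functions on \<open>X\<close>, orthonormal in \<open>\<ell>\<^sup>2(\<pi>)\<close>, consisting of
  eigenfunctions of \<open>P\<close>, the \<open>i\<close>-th one having eigenvalue \<open>\<beta> i\<close>. Consequently
  \<open>\<beta> 1, \<dots>, \<beta> (card X)\<close> are all the eigenvalues of \<open>P\<close>, listed with multiplicity.
  Linear independence is implied by orthonormality.\<close>

definition orthonormal_eigenbasis ::
    "'a set \<Rightarrow> ('a \<Rightarrow> 'a \<Rightarrow> real) \<Rightarrow> ('a \<Rightarrow> real) \<Rightarrow> (nat \<Rightarrow> real) \<Rightarrow> (nat \<Rightarrow> 'a \<Rightarrow> real) \<Rightarrow> bool" where
  "orthonormal_eigenbasis X P \<pi> \<beta> f \<longleftrightarrow>
     (\<forall>i\<in>{1..card X}. \<forall>x\<in>X. (\<Sum>y\<in>X. P x y * f i y) = \<beta> i * f i x) \<and>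
     (\<forall>i\<in>{1..card X}. \<forall>j\<in>{1..card X}. l2_inner X \<pi> (f i) (f j) = (if i = j then 1 else 0)) \<and>
     (\<forall>h :: 'a \<Rightarrow> real. \<exists>a :: nat \<Rightarrow> real. \<forall>x\<in>X. h x = (\<Sum>i=1..card X. a i * f i x))"

text \<open>\<open>1 = \<beta> 1 > \<beta> 2 \<ge> \<dots> \<ge> \<beta> m \<ge> 0\<close>\<close>

definition nonneg_ordered_spectrum :: "nat \<Rightarrow> (nat \<Rightarrow> real) \<Rightarrow> bool" where
  "nonneg_ordered_spectrum m \<beta> \<longleftrightarrow> \<beta> 1 = 1 \<and> (2 \<le> m \<longrightarrow> \<beta> 2 < 1) \<and>
     (\<forall>i j. 2 \<le> i \<and> i \<le> j \<and> j \<le> m \<longrightarrow> \<beta> j \<le> \<beta> i) \<and> (\<forall>i\<in>{1..m}. 0 \<le> \<beta> i)"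

text \<open>The real-time extension of the total variation distance to stationarity. For positive
  integers \<open>t\<close>, the spectral decomposition identifies it with
  \<open>1/2 * (\<Sum>y\<in>X. \<bar>matrix_power X P t x y - \<pi> y\<bar>)\<close>.
  The convention \<open>0\<^sup>t = 0\<close> for \<open>t > 0\<close> agrees with \<open>powr\<close>.\<close>

definition tv_distance ::
    "'a set \<Rightarrow> ('a \<Rightarrow> real) \<Rightarrow> (nat \<Rightarrow> real) \<Rightarrow> (nat \<Rightarrow> 'a \<Rightarrow> real) \<Rightarrow> 'a \<Rightarrow> real \<Rightarrow> real" where
  "tv_distance X \<pi> \<beta> f x t =
     1 / 2 * (\<Sum>y\<in>X. \<pi> y * \<bar>\<Sum>i=2..card X. f i x * f i y * \<beta> i powr t\<bar>)"

text \<open>In the iterated limits \<open>lim\<^bsub>c \<rightarrow> \<infinity>\<^esub> lim\<^bsub>n \<rightarrow> \<infinity>\<^esub>\<close> the inner limit is required to exist for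
  all sufficiently large \<open>c\<close>.\<close>

definition tv_cutoff ::
    "(nat \<Rightarrow> real \<Rightarrow> real) \<Rightarrow> (nat \<Rightarrow> real) \<Rightarrow> (nat \<Rightarrow> real) \<Rightarrow> bool" where
  "tv_cutoff d t w \<longleftrightarrow>
     (\<forall>n. 0 < t n) \<and> (\<forall>n. 0 < w n) \<and> w \<in> o[sequentially](t) \<and>
     (\<exists>L. (\<forall>\<^sub>F c in at_top. (\<lambda>n. d n (t n - c * w n)) \<longlonglongrightarrow> L c) \<and> (L \<longlongrightarrow> 1) at_top) \<and>
     (\<exists>U. (\<forall>\<^sub>F c in at_top. (\<lambda>n. d n (t n + c * w n)) \<longlonglongrightarrow> U c) \<and> (U \<longlongrightarrow> 0) at_top)"

end

theory Submission
  imports Defs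
begin

text \<open>By Cauchy--Schwarz and orthonormality, half the \<open>\<ell>\<^sup>1(\<pi>)\<close> distance between the two signed
  densities at times \<open>s \<le> s'\<close> is at most half their \<open>\<ell>\<^sup>2(\<pi>)\<close> distance, and
  \<open>0 \<le> \<beta>\<^sup>s - \<beta>\<^sup>s' \<le> (s' - s) |ln \<beta>| \<beta>\<^sup>s\<close> termwise. For \<open>s = t\<^sub>n + a w\<^sub>n\<close>, \<open>s' = t\<^sub>n + b w\<^sub>n\<close> the
  hypothesis on \<open>g\<close> then makes \<open>\<Phi>\<close> Lipschitz on every interval on which \<open>g\<close> is bounded above.\<close>

lemma abs_powr_diff_le:
  fixes b s s' :: real
  assumes b: "0 \<le> b" "b \<le> 1" and s: "s \<le> s'"
  shows "\<bar>b powr s - b powr s'\<bar> \<le> (s' - s) * (\<bar>ln b\<bar> * b powr s)"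
proof (cases "b = 0")
  case False
  with b have b0: "0 < b" by simp
  have "b powr s' = b powr s * exp ((s' - s) * ln b)"
    using b0 by (simp add: powr_def flip: exp_add) (simp add: algebra_simps)
  \<comment> \<open>With \<open>u = (s' - s) * ln b\<close>, which is at most 0, the tangent line of
    \<open>exp\<close> at 0 gives \<open>1 + u \<le> exp u \<le> 1\<close>; hence
    \<open>1 - exp u\<close> lies between 0 and \<open>-u\<close>.\<close>
  moreover have "1 + (s' - s) * ln b \<le> exp ((s' - s) * ln b)"
    by (rule exp_ge_add_one_self)
  moreover have "(s' - s) * ln b \<le> 0"
    using b0 b s by (intro mult_nonneg_nonpos) auto
  then have "exp ((s' - s) * ln b) \<le> 1" by simp
  ultimately have "\<bar>b powr s - b powr s'\<bar> = b powr s * (1 - exp ((s' - s) * ln b))"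
    and "1 - exp ((s' - s) * ln b) \<le> (s' - s) * \<bar>ln b\<bar>"
    using b0 b by (auto simp: algebra_simps abs_if ln_less_zero_iff mult_left_le)
  then show ?thesis
    using mult_left_mono[of "1 - exp ((s' - s) * ln b)" "(s' - s) * \<bar>ln b\<bar>" "b powr s"]
    by (simp add: mult_ac)
\<comment> \<open>For \<open>b = 0\<close> both sides vanish: \<open>0 powr r = 0\<close> for every
  real \<open>r\<close>, whatever its sign.\<close>
qed simp

text \<open>Cauchy--Schwarz after splitting each weight as
  \<open>sqrt (\<pi> y) * sqrt (\<pi> y)\<close>; since \<open>\<pi>\<close> has total mass one, the
  first factor drops out.\<close>

lemma sum_abs_le_sqrt_l2_inner:
  assumes "finite X" "\<And>y. y \<in> X \<Longrightarrow> 0 \<le> \<pi> y" "(\<Sum>y\<in>X. \<pi> y) = 1"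
  shows "(\<Sum>y\<in>X. \<pi> y * \<bar>h y\<bar>) \<le> sqrt (l2_inner X \<pi> h h)"
proof (rule real_le_rsqrt)
  have "(\<Sum>y\<in>X. sqrt (\<pi> y) * (sqrt (\<pi> y) * \<bar>h y\<bar>))\<^sup>2
      \<le> (\<Sum>y\<in>X. (sqrt (\<pi> y))\<^sup>2) * (\<Sum>y\<in>X. (sqrt (\<pi> y) * \<bar>h y\<bar>)\<^sup>2)"
    by (rule Cauchy_Schwarz_ineq_sum)
  also have "(\<Sum>y\<in>X. (sqrt (\<pi> y))\<^sup>2) = 1"
    using assms by simp
  also have "(\<Sum>y\<in>X. (sqrt (\<pi> y) * \<bar>h y\<bar>)\<^sup>2) = l2_inner X \<pi> h h"
    unfolding l2_inner_def using assms(2)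
    by (intro sum.cong) (auto simp: power_mult_distrib power2_eq_square[of "h _"])
  also have "(\<Sum>y\<in>X. sqrt (\<pi> y) * (sqrt (\<pi> y) * \<bar>h y\<bar>)) = (\<Sum>y\<in>X. \<pi> y * \<bar>h y\<bar>)"
    using assms(2) by (intro sum.cong) (auto simp flip: mult.assoc)
  finally show "(\<Sum>y\<in>X. \<pi> y * \<bar>h y\<bar>)\<^sup>2 \<le> l2_inner X \<pi> h h" by simp
qed

text \<open>Parseval's identity: after expanding the product, only the diagonal terms survive. The
  index set is kept general because the application sums from \<open>i = 2\<close>, leaving out the
  stationary mode.\<close>

lemma l2_inner_orthonormal_sum:
  assumes "finite I"
    and orth: "\<And>i j. i \<in> I \<Longrightarrow> j \<in> I \<Longrightarrow> l2_inner X \<pi> (f i) (f j) = (if i = j then 1 else 0)"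
  shows "l2_inner X \<pi> (\<lambda>y. \<Sum>i\<in>I. a i * f i y) (\<lambda>y. \<Sum>i\<in>I. a i * f i y) = (\<Sum>i\<in>I. (a i)\<^sup>2)"
proof -
  have "l2_inner X \<pi> (\<lambda>y. \<Sum>i\<in>I. a i * f i y) (\<lambda>y. \<Sum>i\<in>I. a i * f i y)
      = (\<Sum>y\<in>X. \<Sum>i\<in>I. \<Sum>j\<in>I. a i * a j * (\<pi> y * f i y * f j y))"
    unfolding l2_inner_def mult.assoc[of "\<pi> _"] sum_product
    by (simp add: sum_distrib_left mult_ac)
  also have "\<dots> = (\<Sum>i\<in>I. \<Sum>j\<in>I. \<Sum>y\<in>X. a i * a j * (\<pi> y * f i y * f j y))"
    by (subst sum.swap, rule sum.cong, rule refl, rule sum.swap)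
  also have "\<dots> = (\<Sum>i\<in>I. \<Sum>j\<in>I. a i * a j * l2_inner X \<pi> (f i) (f j))"
    by (simp add: l2_inner_def sum_distrib_left)
  also have "\<dots> = (\<Sum>i\<in>I. \<Sum>j\<in>I. if i = j then a i * a j else 0)"
    by (intro sum.cong) (auto simp: orth)
  also have "\<dots> = (\<Sum>i\<in>I. (a i)\<^sup>2)"
    using assms(1) by (simp add: power2_eq_square)
  finally show ?thesis .
qed

lemma nonneg_ordered_spectrum_bounds:
  assumes "nonneg_ordered_spectrum m \<beta>" "i \<in> {2..m}"
  shows "0 \<le> \<beta> i" "\<beta> i \<le> 1"
proof -
  show "0 \<le> \<beta> i"
    using assms by (auto simp: nonneg_ordered_spectrum_def)
  have "\<beta> i \<le> \<beta> 2" "\<beta> 2 < 1"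
    using assms by (auto simp: nonneg_ordered_spectrum_def)
  then show "\<beta> i \<le> 1" by simp
qed

text \<open>The quantitative core. The sum is evaluated at the earlier time \<open>s\<close>, so
  that it matches the sum in the limsup hypothesis. Both times may be arbitrary reals, so the bound
  can be used for every \<open>n\<close>, even while \<open>t n + a * w n\<close> is not yet
  positive.\<close>

lemma tv_distance_diff_le:
  assumes X: "finite X" and stat: "stationary_measure X P \<pi>"
    and spec: "nonneg_ordered_spectrum (card X) \<beta>"
    and basis: "orthonormal_eigenbasis X P \<pi> \<beta> f"
    and s: "s \<le> s'"
  shows "\<bar>tv_distance X \<pi> \<beta> f x s - tv_distance X \<pi> \<beta> f x s'\<bar>
    \<le> (s' - s) / 2 * sqrt (\<Sum>i=2..card X. (f i x)\<^sup>2 * (ln (\<beta> i))\<^sup>2 * \<beta> i powr (2 * s))"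
proof -
  define I where "I = {2..card X}"
  define u where "u r y = (\<Sum>i\<in>I. f i x * f i y * \<beta> i powr r)" for r y
  define a where "a i = f i x * (\<beta> i powr s - \<beta> i powr s')" for i
  have \<pi>: "\<And>y. y \<in> X \<Longrightarrow> 0 \<le> \<pi> y" "(\<Sum>y\<in>X. \<pi> y) = 1"
    using stat by (auto simp: stationary_measure_def)
  have diff: "u s y - u s' y = (\<Sum>i\<in>I. a i * f i y)" for y
    by (simp add: u_def a_def algebra_simps flip: sum_subtractf)
  have "tv_distance X \<pi> \<beta> f x s - tv_distance X \<pi> \<beta> f x s'
      = 1 / 2 * (\<Sum>y\<in>X. \<pi> y * (\<bar>u s y\<bar> - \<bar>u s' y\<bar>))"
    by (simp add: tv_distance_def u_def I_def right_diff_distrib sum_subtractf diff_divide_distrib)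
  then have "2 * \<bar>tv_distance X \<pi> \<beta> f x s - tv_distance X \<pi> \<beta> f x s'\<bar>
      = \<bar>\<Sum>y\<in>X. \<pi> y * (\<bar>u s y\<bar> - \<bar>u s' y\<bar>)\<bar>"
    by (simp only: abs_mult)
  also have "\<dots> \<le> (\<Sum>y\<in>X. \<bar>\<pi> y * (\<bar>u s y\<bar> - \<bar>u s' y\<bar>)\<bar>)"
    by (rule sum_abs)
  \<comment> \<open>Reverse triangle inequality, using that the weights are nonnegative.\<close>
  also have "\<dots> \<le> (\<Sum>y\<in>X. \<pi> y * \<bar>u s y - u s' y\<bar>)"
    using \<pi>(1) by (intro sum_mono) (auto simp: abs_mult intro!: mult_left_mono)
  also have "\<dots> \<le> sqrt (l2_inner X \<pi> (\<lambda>y. u s y - u s' y) (\<lambda>y. u s y - u s' y))"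
    by (rule sum_abs_le_sqrt_l2_inner[OF X \<pi>])
  also have "\<dots> = sqrt (\<Sum>i\<in>I. (a i)\<^sup>2)"
    unfolding diff
    by (subst l2_inner_orthonormal_sum)
       (use basis in \<open>auto simp: orthonormal_eigenbasis_def I_def\<close>)
  \<comment> \<open>Moving the constant inside the sum reduces the claim to one eigenvalue at a
    time, where \<open>abs_powr_diff_le\<close> applies.\<close>
  also have "\<dots> \<le> sqrt ((s' - s)\<^sup>2 * (\<Sum>i\<in>I. (f i x)\<^sup>2 * (ln (\<beta> i))\<^sup>2 * \<beta> i powr (2 * s)))"
    unfolding sum_distrib_left
  proof (intro real_sqrt_le_mono sum_mono)
    fix i assume "i \<in> I"
    then have "0 \<le> \<beta> i" "\<beta> i \<le> 1"
      using nonneg_ordered_spectrum_bounds[OF spec] by (auto simp: I_def)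
    then have "\<bar>a i\<bar> \<le> \<bar>f i x\<bar> * ((s' - s) * (\<bar>ln (\<beta> i)\<bar> * \<beta> i powr s))"
      unfolding a_def abs_mult by (intro mult_left_mono abs_powr_diff_le s) auto
    then have "\<bar>a i\<bar>\<^sup>2 \<le> (\<bar>f i x\<bar> * ((s' - s) * (\<bar>ln (\<beta> i)\<bar> * \<beta> i powr s)))\<^sup>2"
      by (intro power_mono) auto
    also have "\<dots> = (s' - s)\<^sup>2 * ((f i x)\<^sup>2 * (ln (\<beta> i))\<^sup>2 * (\<beta> i powr s)\<^sup>2)"
      by (simp add: power_mult_distrib)
    also have "(\<beta> i powr s)\<^sup>2 = \<beta> i powr (2 * s)"
      by (simp add: power2_eq_square flip: powr_add)
    finally show "(a i)\<^sup>2 \<le> (s' - s)\<^sup>2 * ((f i x)\<^sup>2 * (ln (\<beta> i))\<^sup>2 * \<beta> i powr (2 * s))"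
      by simp
  qed
  also have "\<dots> = (s' - s) * sqrt (\<Sum>i\<in>I. (f i x)\<^sup>2 * (ln (\<beta> i))\<^sup>2 * \<beta> i powr (2 * s))"
    using s by (simp add: real_sqrt_mult)
  finally show ?thesis by (simp add: I_def)
qed

theorem theorem5:
  fixes X :: "nat \<Rightarrow> 'a set"
    and P :: "nat \<Rightarrow> 'a \<Rightarrow> 'a \<Rightarrow> real"
    and \<pi> :: "nat \<Rightarrow> 'a \<Rightarrow> real"
    and \<beta> :: "nat \<Rightarrow> nat \<Rightarrow> real"
    and f :: "nat \<Rightarrow> nat \<Rightarrow> 'a \<Rightarrow> real"
    and x :: "nat \<Rightarrow> 'a"
    and t w :: "nat \<Rightarrow> real"
    and g \<Phi> :: "real \<Rightarrow> real"
  assumes "\<And>n. transition_matrix (X n) (P n)"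
    and "\<And>n. irreducible_chain (X n) (P n)"
    and "\<And>n. aperiodic_chain (X n) (P n)"
    and "\<And>n. stationary_measure (X n) (P n) (\<pi> n)"
    and "\<And>n. reversible_chain (X n) (P n) (\<pi> n)"
    and "\<And>n. nonneg_ordered_spectrum (card (X n)) (\<beta> n)"
    and "\<And>n. orthonormal_eigenbasis (X n) (P n) (\<pi> n) (\<beta> n) (f n)"
    and "\<And>n. x n \<in> X n"
    and "tv_cutoff (\<lambda>n. tv_distance (X n) (\<pi> n) (\<beta> n) (f n) (x n)) t w"
    and "continuous_on UNIV g \<or> bounded (range g)"
    and "\<And>c. limsup (\<lambda>n. ereal (w n * sqrt (\<Sum>i=2..card (X n).
            (f n i (x n))\<^sup>2 * (ln (\<beta> n i))\<^sup>2 * \<beta> n i powr (2 * (t n + c * w n))))) \<le> ereal (g c)"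
    and "\<And>c. (\<lambda>n. tv_distance (X n) (\<pi> n) (\<beta> n) (f n) (x n) (t n + c * w n)) \<longlonglongrightarrow> \<Phi> c"
  shows "continuous_on UNIV \<Phi>"
proof -
  define d where "d n = tv_distance (X n) (\<pi> n) (\<beta> n) (f n) (x n)" for n
  define A where "A n c = w n * sqrt (\<Sum>i=2..card (X n).
      (f n i (x n))\<^sup>2 * (ln (\<beta> n i))\<^sup>2 * \<beta> n i powr (2 * (t n + c * w n)))" for n c
  have w: "0 < w n" for n
    using assms(9) by (simp add: tv_cutoff_def)
  have d_diff: "\<bar>d n (t n + a * w n) - d n (t n + b * w n)\<bar> \<le> (b - a) / 2 * A n a"
    \<comment> \<open>The elapsed time \<open>(b - a) * w n\<close> supplies the factor
      \<open>w n\<close> that turns the square root into \<open>A n a\<close>.\<close>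
    if "a \<le> b" for n a b
  proof -
    have "t n + a * w n \<le> t n + b * w n"
      using that w[of n] by simp
    moreover have "finite (X n)"
      using assms(1)[of n] by (simp add: transition_matrix_def)
    ultimately have "\<bar>d n (t n + a * w n) - d n (t n + b * w n)\<bar>
        \<le> (t n + b * w n - (t n + a * w n)) / 2 * (A n a / w n)"
      using tv_distance_diff_le[OF _ assms(4) assms(6) assms(7),
          where s = "t n + a * w n" and s' = "t n + b * w n" and x = "x n"] w[of n]
      by (simp add: d_def A_def)
    also have "\<dots> = (b - a) / 2 * A n a"
      using w[of n] by (simp add: field_simps)
    finally show ?thesis .
  qed
  \<comment> \<open>\<open>K\<close> lies strictly above \<open>g a\<close> because a limsup of at
    most \<open>g a\<close> bounds \<open>A n a\<close> eventually only by numbers larger than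
    \<open>g a\<close>. The estimate then passes to the limit in \<open>n\<close>.\<close>
  have \<Phi>_diff: "\<bar>\<Phi> a - \<Phi> b\<bar> \<le> (b - a) / 2 * K" if "a \<le> b" "g a < K" for a b K
  proof (rule tendsto_upperbound)
    show "(\<lambda>n. \<bar>d n (t n + a * w n) - d n (t n + b * w n)\<bar>) \<longlonglongrightarrow> \<bar>\<Phi> a - \<Phi> b\<bar>"
      unfolding d_def by (intro tendsto_intros assms(12))
    have "limsup (\<lambda>n. ereal (A n a)) < ereal K"
      using assms(11)[of a] that(2) unfolding A_def by (meson le_less_trans less_ereal.simps(1))
    then have "\<forall>\<^sub>F n in sequentially. A n a < K"
      by (auto dest: Limsup_lessD)
    then show "\<forall>\<^sub>F n in sequentially.
        \<bar>d n (t n + a * w n) - d n (t n + b * w n)\<bar> \<le> (b - a) / 2 * K"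
    proof eventually_elim
      case (elim n)
      then have "(b - a) / 2 * A n a \<le> (b - a) / 2 * K"
        using that(1) by (intro mult_left_mono) auto
      with d_diff[OF that(1), of n] show ?case by linarith
    qed
  qed simp
  \<comment> \<open>The argument is local, since a continuous \<open>g\<close> need be bounded only
    on compact sets: \<open>g\<close> is bounded on the closed interval, and the open one has
    \<open>c\<close> in its interior.\<close>
  have "continuous_on {c - 1<..<c + 1} \<Phi>" for c
  proof -
    have "bounded (g ` {c - 1..c + 1})"
      using assms(10)
    proof
      assume "continuous_on UNIV g"
      then show ?thesis
        by (meson compact_Icc compact_continuous_image compact_imp_bounded continuous_on_subset
            subset_UNIV)
    next
      assume "bounded (range g)"
      then show ?thesis
        by (rule bounded_subset) auto
    qed
    then obtain M where M: "\<And>a. a \<in> {c - 1..c + 1} \<Longrightarrow> \<bar>g a\<bar> \<le> M"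
      unfolding bounded_iff real_norm_def by blast
    have M0: "0 \<le> M"
      using M[of c] by simp
    \<comment> \<open>Taking \<open>M + 1\<close> in place of \<open>M\<close> gives the strict
      inequality that \<open>\<Phi>_diff\<close> asks for.\<close>
    have lip: "\<bar>\<Phi> a - \<Phi> b\<bar> \<le> (M + 1) / 2 * (b - a)"
      if "a \<in> {c - 1<..<c + 1}" "a \<le> b" for a b
      using \<Phi>_diff[OF that(2), of "M + 1"] M[of a] that(1) by (auto simp: mult_ac)
    have "((M + 1) / 2)-lipschitz_on {c - 1<..<c + 1} \<Phi>"
    proof (rule lipschitz_onI)
      fix a b assume "a \<in> {c - 1<..<c + 1}" "b \<in> {c - 1<..<c + 1}"
      then show "dist (\<Phi> a) (\<Phi> b) \<le> (M + 1) / 2 * dist a b"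
        using lip[of a b] lip[of b a]
        by (cases "a \<le> b") (simp_all add: dist_real_def abs_minus_commute)
    qed (use M0 in simp)
    then show ?thesis
      by (rule lipschitz_on_continuous_on)
  qed
  then have "isCont \<Phi> c" for c
    by (rule continuous_on_interior[of "{c - 1<..<c + 1}"]) auto
  then show ?thesis
    by (simp add: continuous_at_imp_continuous_on)
qed

end
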